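(* Let $\mathcal{H}_1,\mathcal{H}_2$ be separable Hilbert spaces, let $(\psi_k)_{k\in K}\subseteq\mathcal{H}_1$ be a Bessel sequence with $\psi_k\ne0$ for all $k$, and let $(\phi_k)_{k\in K}\subseteq\mathcal{H}_2$ be a Riesz sequence. Then the mapping $m\mapsto\mathbf{M}_{m,(\phi_k),(\psi_k)}$ is injective from $l^\infty(K)$ into $\mathcal{B}(\mathcal{H}_1,\mathcal{H}_2)$.
   Context: $K$ is a countable index set. Inner products are linear in the first argument. A sequence $(\psi_k)_{k\in K}$ in $\mathcal{H}$ is a Bessel sequence if there is $B>0$ with $\sum_k|\langle f,\psi_k\rangle|^2\le B\|f\|^2$ for all $f\in\mathcal{H}$. A sequence $(\phi_k)$ is a Riesz sequence if it is a Riesz basis for its closed linear span, i.e. there are $A,B>0$ with $A\|c\|_2^2\le\|\sum_k c_k\phi_k\|^2\le B\|c\|_2^2$ for all $c\in l^2(K)$. The Bessel multiplier is $\mathbf{M}_{m,(\phi_k),(\psi_k)}:\mathcal{H}_1\to\mathcal{H}_2$, $f\mapsto\sum_k m_k\langle f,\psi_k\rangle\phi_k$. $\mathcal{B}(\mathcal{H}_1,\mathcal{H}_2)$ is the space of bounded linear operators. *)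

theory Defs
  imports "HOL-Analysis.Analysis"
begin

text \<open>Complex inner product spaces. The inner product is linear in its first argument; the real
  scalar multiplication, the norm, the metric and the topology are those of the superclass,
  tied to the complex structure by the last two class axioms below.\<close>

class complex_inner = real_normed_vector +
  fixes scaleC :: "complex \<Rightarrow> 'a \<Rightarrow> 'a"  (infixr \<open>*\<^sub>C\<close> 75)
    and cinner :: "'a \<Rightarrow> 'a \<Rightarrow> complex"
  assumes scaleC_add_right: "a *\<^sub>C (x + y) = a *\<^sub>C x + a *\<^sub>C y"
    and scaleC_add_left: "(a + b) *\<^sub>C x = a *\<^sub>C x + b *\<^sub>C x"
    and scaleC_scaleC: "a *\<^sub>C b *\<^sub>C x = (a * b) *\<^sub>C x"
    and scaleC_one: "1 *\<^sub>C x = x"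
    and cinner_commute: "cinner x y = cnj (cinner y x)"
    and cinner_add_left: "cinner (x + y) z = cinner x z + cinner y z"
    and cinner_scaleC_left: "cinner (a *\<^sub>C x) y = a * cinner x y"
    and cinner_self_nonneg: "0 \<le> Re (cinner x x)"
    and cinner_self_eq_zero: "cinner x x = 0 \<longleftrightarrow> x = 0"
    and scaleR_scaleC: "r *\<^sub>R x = complex_of_real r *\<^sub>C x"
    and norm_eq_sqrt_cinner: "norm x = sqrt (Re (cinner x x))"

class complex_hilbert_space = complex_inner + complete_space

instantiation complex :: complex_hilbert_space
begin

definition scaleC_complex :: "complex \<Rightarrow> complex \<Rightarrow> complex" where
  "scaleC_complex a x = a * x"

definition cinner_complex :: "complex \<Rightarrow> complex \<Rightarrow> complex" where
  "cinner_complex x y = x * cnj y"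

instance
proof
  fix x :: complex
  show "norm x = sqrt (Re (cinner x x))"
    by (simp add: cinner_complex_def complex_mult_cnj cmod_def)
qed (simp_all add: scaleC_complex_def cinner_complex_def algebra_simps scaleR_conv_of_real)

end

definition bounded_clinear ::
    "('a::complex_inner \<Rightarrow> 'b::complex_inner) \<Rightarrow> bool" where
  "bounded_clinear T \<longleftrightarrow> bounded_linear T \<and> (\<forall>a x. T (a *\<^sub>C x) = a *\<^sub>C T x)"

text \<open>Complex sequences indexed by \<open>K\<close> are functions in \<open>K \<rightarrow>\<^sub>E UNIV\<close>, so that two of them are equal
  iff they agree on \<open>K\<close>. Since \<open>infsum\<close> is 0 for divergent sums, convergence is always required
  explicitly.\<close>

definition ell_infinity :: "'k set \<Rightarrow> ('k \<Rightarrow> complex) set" where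
  "ell_infinity K = {m \<in> K \<rightarrow>\<^sub>E UNIV. bounded (m ` K)}"

definition ell_two :: "'k set \<Rightarrow> ('k \<Rightarrow> complex) set" where
  "ell_two K = {c \<in> K \<rightarrow>\<^sub>E UNIV. (\<lambda>k. (cmod (c k))\<^sup>2) summable_on K}"

definition ell_two_norm :: "'k set \<Rightarrow> ('k \<Rightarrow> complex) \<Rightarrow> real" where
  "ell_two_norm K c = sqrt (\<Sum>\<^sub>\<infinity>k\<in>K. (cmod (c k))\<^sup>2)"

definition Bessel_sequence :: "'k set \<Rightarrow> ('k \<Rightarrow> 'a::complex_inner) \<Rightarrow> bool" where
  "Bessel_sequence K \<psi> \<longleftrightarrow> (\<exists>B>0. \<forall>f.
     (\<lambda>k. (cmod (cinner f (\<psi> k)))\<^sup>2) summable_on K \<and>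
     (\<Sum>\<^sub>\<infinity>k\<in>K. (cmod (cinner f (\<psi> k)))\<^sup>2) \<le> B * (norm f)\<^sup>2)"

definition Riesz_sequence :: "'k set \<Rightarrow> ('k \<Rightarrow> 'a::complex_inner) \<Rightarrow> bool" where
  "Riesz_sequence K \<phi> \<longleftrightarrow> (\<exists>A>0. \<exists>B>0. \<forall>c\<in>ell_two K.
     (\<lambda>k. c k *\<^sub>C \<phi> k) summable_on K \<and>
     A * (ell_two_norm K c)\<^sup>2 \<le> (norm (\<Sum>\<^sub>\<infinity>k\<in>K. c k *\<^sub>C \<phi> k))\<^sup>2 \<and>
     (norm (\<Sum>\<^sub>\<infinity>k\<in>K. c k *\<^sub>C \<phi> k))\<^sup>2 \<le> B * (ell_two_norm K c)\<^sup>2)"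

definition multiplier ::
    "'k set \<Rightarrow> ('k \<Rightarrow> complex) \<Rightarrow> ('k \<Rightarrow> 'b::complex_inner) \<Rightarrow> ('k \<Rightarrow> 'a::complex_inner) \<Rightarrow> 'a \<Rightarrow> 'b" where
  "multiplier K m \<phi> \<psi> f = (\<Sum>\<^sub>\<infinity>k\<in>K. (m k * cinner f (\<psi> k)) *\<^sub>C \<phi> k)"

end

theory Submission imports Defs begin

text \<open>For bounded \<open>m\<close> the coefficients \<open>m\<^sub>k \<langle>f, \<psi>\<^sub>k\<rangle>\<close> are square summable by the Bessel property,
  so the upper Riesz bound makes the multiplier a bounded operator. If two multipliers agree, the
  lower Riesz bound forces their coefficients at \<open>f\<close> to agree for every \<open>f\<close>; the choice
  \<open>f = \<psi>\<^sub>k \<noteq> 0\<close> then isolates the \<open>k\<close>-th entries of the symbols.\<close>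

text \<open>Conjugate symmetry moves the scalar out of the second argument as \<open>cnj a\<close>,
  and \<open>a * cnj a\<close> is the squared modulus.\<close>

lemma norm_scaleC: "norm (a *\<^sub>C x) = cmod a * norm (x::'a::complex_inner)"
proof -
  have "cinner (a *\<^sub>C x) (a *\<^sub>C x) = a * cnj a * cinner x x"
    by (metis cinner_commute cinner_scaleC_left complex_cnj_mult mult.assoc)
  also have "\<dots> = complex_of_real ((cmod a)\<^sup>2) * cinner x x"
    by (simp only: complex_norm_square)
  finally have "Re (cinner (a *\<^sub>C x) (a *\<^sub>C x)) = (cmod a)\<^sup>2 * Re (cinner x x)"
    by simp
  then show ?thesis
    by (simp add: norm_eq_sqrt_cinner[of x] norm_eq_sqrt_cinner[of "a *\<^sub>C x"] real_sqrt_mult)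
qed

text \<open>Continuity lets scaling be exchanged with infinite sums, as complex homogeneity of the
  multiplier requires.\<close>

lemma bounded_linear_scaleC_right: "bounded_linear (\<lambda>x::'a::complex_inner. a *\<^sub>C x)"
  by (rule bounded_linear_intro[where K = "cmod a"])
    (simp_all add: scaleC_add_right scaleR_scaleC scaleC_scaleC norm_scaleC mult.commute)

lemma ell_two_norm_power2: "(ell_two_norm K c)\<^sup>2 = (\<Sum>\<^sub>\<infinity>k\<in>K. (cmod (c k))\<^sup>2)"
  by (simp add: ell_two_norm_def infsum_nonneg)

text \<open>Membership in \<open>ell_two K\<close> matters: a divergent \<open>infsum\<close> is 0
  as well, and only for a summable nonnegative family does a zero sum force zero terms.\<close>

lemma ell_two_norm_eq_0_imp:
  assumes "c \<in> ell_two K" "ell_two_norm K c = 0" "k \<in> K"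
  shows "c k = 0"
proof -
  have "(\<Sum>\<^sub>\<infinity>k\<in>K. (cmod (c k))\<^sup>2) = 0"
    using assms(2) ell_two_norm_power2[of K c] by simp
  moreover have "(\<lambda>k. (cmod (c k))\<^sup>2) summable_on K"
    using assms(1) by (simp add: ell_two_def)
  ultimately have "(cmod (c k))\<^sup>2 = 0"
    using assms(3) nonneg_infsum_le_0D[of "\<lambda>k. (cmod (c k))\<^sup>2" K k] by simp
  then show ?thesis by simp
qed

lemma ell_infinity_bound:
  assumes "m \<in> ell_infinity K"
  obtains M where "\<forall>k\<in>K. cmod (m k) \<le> M"
  using assms by (auto simp: ell_infinity_def bounded_iff)

text \<open>Termwise comparison with \<open>M\<^sup>2\<close> times the Bessel series. The
  coefficients are restricted to \<open>K\<close> because members of \<open>ell_two K\<close> are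
  extensional.\<close>

lemma ell_two_mult_Bessel:
  assumes "Bessel_sequence K \<psi>" and m: "\<forall>k\<in>K. cmod (m k) \<le> M"
  shows "(\<lambda>k\<in>K. m k * cinner f (\<psi> k)) \<in> ell_two K"
    and "(ell_two_norm K (\<lambda>k\<in>K. m k * cinner f (\<psi> k)))\<^sup>2
           \<le> M\<^sup>2 * (\<Sum>\<^sub>\<infinity>k\<in>K. (cmod (cinner f (\<psi> k)))\<^sup>2)"
proof -
  let ?c = "\<lambda>k\<in>K. m k * cinner f (\<psi> k)" and ?g = "\<lambda>k. (cmod (cinner f (\<psi> k)))\<^sup>2"
  have g: "(\<lambda>k. M\<^sup>2 * ?g k) summable_on K"
    using assms(1) by (intro summable_on_cmult_right) (auto simp: Bessel_sequence_def)
  \<comment> \<open>No sign of \<open>M\<close> is assumed: squaring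
    \<open>cmod (m k) \<le> M\<close> only needs the left side to be nonnegative.\<close>
  have le: "(cmod (?c k))\<^sup>2 \<le> M\<^sup>2 * ?g k" if "k \<in> K" for k
    using that bspec[OF m that]
    by (auto simp: norm_mult power_mult_distrib intro!: mult_right_mono power_mono)
  have s: "(\<lambda>k. (cmod (?c k))\<^sup>2) summable_on K"
    by (rule summable_on_comparison_test[OF g le]) simp_all
  then show "?c \<in> ell_two K"
    by (simp add: ell_two_def)
  show "(ell_two_norm K ?c)\<^sup>2 \<le> M\<^sup>2 * (\<Sum>\<^sub>\<infinity>k\<in>K. ?g k)"
    unfolding ell_two_norm_power2 infsum_cmult_right'[symmetric]
    by (rule infsum_mono[OF s g le])
qed

lemma multiplier_summable:
  assumes "Bessel_sequence K \<psi>" "Riesz_sequence K \<phi>" "m \<in> ell_infinity K"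
  shows "(\<lambda>k. (m k * cinner f (\<psi> k)) *\<^sub>C \<phi> k) summable_on K"
proof -
  obtain M where M: "\<forall>k\<in>K. cmod (m k) \<le> M"
    using ell_infinity_bound[OF assms(3)] by blast
  have "(\<lambda>k. (\<lambda>k\<in>K. m k * cinner f (\<psi> k)) k *\<^sub>C \<phi> k) summable_on K"
    using ell_two_mult_Bessel(1)[OF assms(1) M, where f = f] assms(2)
    unfolding Riesz_sequence_def by blast
  then show ?thesis
    by (rule summable_on_cong[THEN iffD1, rotated]) simp
qed

text \<open>Puts the multiplier into the form to which the Riesz bounds, stated for
  \<open>c \<in> ell_two K\<close>, apply.\<close>

lemma multiplier_eq_infsum_restrict:
  "multiplier K m \<phi> \<psi> f = (\<Sum>\<^sub>\<infinity>k\<in>K. (\<lambda>k\<in>K. m k * cinner f (\<psi> k)) k *\<^sub>C \<phi> k)"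
  unfolding multiplier_def by (rule infsum_cong) simp

lemma bounded_clinear_multiplier:
  assumes "Bessel_sequence K \<psi>" "Riesz_sequence K \<phi>" "m \<in> ell_infinity K"
  shows "bounded_clinear (multiplier K m \<phi> \<psi>)"
proof -
  note sum = multiplier_summable[OF assms]
  let ?T = "multiplier K m \<phi> \<psi>"
  have add: "?T (f + g) = ?T f + ?T g" for f g
    unfolding multiplier_def infsum_add[OF sum sum, symmetric]
    by (simp add: cinner_add_left distrib_left scaleC_add_left)
  have scale: "?T (a *\<^sub>C f) = a *\<^sub>C ?T f" for a f
    using infsumI[OF has_sum_bounded_linear[OF bounded_linear_scaleC_right has_sum_infsum[OF sum[of f]]], of a]
    by (simp add: multiplier_def cinner_scaleC_left scaleC_scaleC mult_ac)
  obtain M where M: "\<forall>k\<in>K. cmod (m k) \<le> M"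
    using ell_infinity_bound[OF assms(3)] by blast
  obtain B where B: "B > 0" "\<And>f. (\<Sum>\<^sub>\<infinity>k\<in>K. (cmod (cinner f (\<psi> k)))\<^sup>2) \<le> B * (norm f)\<^sup>2"
    using assms(1) unfolding Bessel_sequence_def by blast
  obtain C where C: "C > 0" "\<And>c. c \<in> ell_two K \<Longrightarrow>
      (norm (\<Sum>\<^sub>\<infinity>k\<in>K. c k *\<^sub>C \<phi> k))\<^sup>2 \<le> C * (ell_two_norm K c)\<^sup>2"
    using assms(2) unfolding Riesz_sequence_def by blast
  \<comment> \<open>\<open>C\<close> is the upper Riesz bound, \<open>M\<close> bounds the symbol
    and \<open>B\<close> is the Bessel bound; together they bound the square of the operator norm by
    their product \<open>C * (M\<^sup>2 * B)\<close>.\<close>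
  have bound: "norm (?T f) \<le> norm f * sqrt (C * (M\<^sup>2 * B))" for f
  proof -
    let ?c = "\<lambda>k\<in>K. m k * cinner f (\<psi> k)"
    have "(norm (?T f))\<^sup>2 \<le> C * (ell_two_norm K ?c)\<^sup>2"
      unfolding multiplier_eq_infsum_restrict
      by (rule C(2)[OF ell_two_mult_Bessel(1)[OF assms(1) M]])
    also have "\<dots> \<le> C * (M\<^sup>2 * (B * (norm f)\<^sup>2))"
      using ell_two_mult_Bessel(2)[OF assms(1) M, where f = f] C(1)
      by (intro mult_left_mono order_trans[OF _ mult_left_mono[OF B(2)]]) simp_all
    finally have "norm (?T f) \<le> sqrt ((C * (M\<^sup>2 * B)) * (norm f)\<^sup>2)"
      by (intro real_le_rsqrt) (simp add: mult_ac)
    then show ?thesis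
      by (simp add: real_sqrt_mult mult_ac)
  qed
  have "bounded_linear ?T"
    by (rule bounded_linear_intro[OF add _ bound]) (simp add: scaleR_scaleC scale)
  then show ?thesis
    using scale by (simp add: bounded_clinear_def)
qed

lemma inj_on_multiplier:
  assumes "Bessel_sequence K \<psi>" "Riesz_sequence K \<phi>" and "\<And>k. k \<in> K \<Longrightarrow> \<psi> k \<noteq> 0"
  shows "inj_on (\<lambda>m. multiplier K m \<phi> \<psi>) (ell_infinity K)"
proof (rule inj_onI)
  fix m n
  assume mn: "m \<in> ell_infinity K" "n \<in> ell_infinity K"
    and eq: "multiplier K m \<phi> \<psi> = multiplier K n \<phi> \<psi>"
  \<comment> \<open>The multiplier is additive in its symbol, so it suffices to show that the
    difference symbol vanishes on \<open>K\<close>.\<close>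
  define d where "d = (\<lambda>k\<in>K. m k - n k)"
  have d: "d \<in> ell_infinity K"
    using mn bounded_minus_comp[of m K n]
    by (simp add: ell_infinity_def d_def)
  obtain M where M: "\<forall>k\<in>K. cmod (d k) \<le> M"
    using ell_infinity_bound[OF d] by blast
  obtain A where A: "A > 0" "\<And>c. c \<in> ell_two K \<Longrightarrow>
      A * (ell_two_norm K c)\<^sup>2 \<le> (norm (\<Sum>\<^sub>\<infinity>k\<in>K. c k *\<^sub>C \<phi> k))\<^sup>2"
    using assms(2) unfolding Riesz_sequence_def by blast
  have "m k = n k" if k: "k \<in> K" for k
  proof -
    let ?f = "\<psi> k"
    let ?c = "\<lambda>j\<in>K. d j * cinner ?f (\<psi> j)"
    note c = ell_two_mult_Bessel(1)[OF assms(1) M, where f = ?f]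
    \<comment> \<open>Splitting \<open>m\<close> as \<open>d + n\<close> on \<open>K\<close>
      expresses the difference through \<open>infsum_add\<close>, both series being
      summable.\<close>
    have "multiplier K m \<phi> \<psi> ?f = multiplier K d \<phi> \<psi> ?f + multiplier K n \<phi> \<psi> ?f"
      unfolding multiplier_def
        infsum_add[OF multiplier_summable[OF assms(1,2) d] multiplier_summable[OF assms(1,2) mn(2)], symmetric]
      by (intro infsum_cong) (simp add: d_def scaleC_add_left[symmetric] algebra_simps)
    then have "multiplier K d \<phi> \<psi> ?f = 0"
      using eq by simp
    \<comment> \<open>The lower Riesz bound applied to a sum equal to 0; since \<open>A > 0\<close>,
      the coefficient sequence has norm 0.\<close>
    then have "A * (ell_two_norm K ?c)\<^sup>2 \<le> 0"
      using A(2)[OF c] unfolding multiplier_eq_infsum_restrict by simp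
    then have "ell_two_norm K ?c = 0"
      using A(1) by (simp add: mult_le_0_iff)
    \<comment> \<open>At \<open>f = \<psi> k\<close> the coefficient with index \<open>k\<close> is
      \<open>d k\<close> times the squared norm of \<open>\<psi> k\<close>, which is
      nonzero.\<close>
    from ell_two_norm_eq_0_imp[OF c this k] have "d k * cinner ?f ?f = 0"
      using k by simp
    then show ?thesis
      using assms(3)[OF k] k by (simp add: cinner_self_eq_zero d_def)
  qed
  then show "m = n"
    \<comment> \<open>Off \<open>K\<close> both symbols take the same default value, so agreement on
      \<open>K\<close> gives equality of functions.\<close>
    using mn by (intro extensionalityI[of _ K]) (auto simp: ell_infinity_def PiE_def)
qed

theorem lemma7p1:
  fixes K :: "'k set"
    and \<psi> :: "'k \<Rightarrow> 'a::complex_hilbert_space"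
    and \<phi> :: "'k \<Rightarrow> 'b::complex_hilbert_space"
  assumes "countable K"
    and "separable_space (euclidean :: 'a topology)"
    and "separable_space (euclidean :: 'b topology)"
    and "Bessel_sequence K \<psi>"
    and "\<And>k. k \<in> K \<Longrightarrow> \<psi> k \<noteq> 0"
    and "Riesz_sequence K \<phi>"
  shows "(\<forall>m \<in> ell_infinity K. \<forall>f. (\<lambda>k. (m k * cinner f (\<psi> k)) *\<^sub>C \<phi> k) summable_on K)
    \<and> (\<lambda>m. multiplier K m \<phi> \<psi>) \<in> ell_infinity K \<rightarrow> {T. bounded_clinear T}
    \<and> inj_on (\<lambda>m. multiplier K m \<phi> \<psi>) (ell_infinity K)"
  using multiplier_summable[OF assms(4,6)] bounded_clinear_multiplier[OF assms(4,6)]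
    inj_on_multiplier[OF assms(4,6,5)]
  by blast

end
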